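(* Let $V$ be a vector space equipped with an injective linear map $Y(\cdot,x):V\to(\mathrm{End}\,V)[[x,x^{-1}]]$, $v\mapsto Y(v,x)=\sum_{n\in\mathbb Z}v_nx^{-n-1}$, such that $Y(u,x)v\in V((x))$ for all $u,v\in V$. Then weak commutativity together with vacuum-free skew-symmetry can replace the Jacobi identity in the definition of vacuum-free vertex algebra; that is, the Jacobi identity $$x_0^{-1}\delta\left(\frac{x_1-x_2}{x_0}\right)Y(u,x_1)Y(v,x_2)-x_0^{-1}\delta\left(\frac{-x_2+x_1}{x_0}\right)Y(v,x_2)Y(u,x_1)=x_1^{-1}\delta\left(\frac{x_2+x_0}{x_1}\right)Y(Y(u,x_0)v,x_2)$$ holds for all $u,v\in V$ if and only if both of the following hold: (weak commutativity) for all $u,v\in V$ there exists an integer $m\ge0$ such that $(x_1-x_2)^{m}\left(Y(u,x_1)Y(v,x_2)-Y(v,x_2)Y(u,x_1)\right)=0$; (vacuum-free skew-symmetry) for all $u,v\in V$, $Y(Y(u,x_0)v,x_2)=Y(Y(v,-x_0)u,x_2+x_0)$.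
   Context: All vector spaces are over $\mathbb C$; formal variables commute. For a vector space $U$, $U[[x,x^{-1}]]$ is the space of all formal Laurent series $\sum_{n\in\mathbb Z}u_nx^n$ with $u_n\in U$; $U((x))$ is the subspace of series with $u_n=0$ for $n$ sufficiently negative. $\delta(x)=\sum_{n\in\mathbb Z}x^n$. Binomial expansion convention: for every $n\in\mathbb Z$, $(x+y)^n=\sum_{k\ge0}\binom nk x^{n-k}y^k$, i.e. binomials are expanded in nonnegative powers of the second-listed variable (likewise with signs, so $(x_1-x_2)^n$ is expanded in nonnegative powers of $x_2$ and $(-x_2+x_1)^n$ in nonnegative powers of $x_1$); this applies inside $\delta$ and to substitutions such as $F(x+y)$. The map $Y$ is extended coefficientwise to series: $Y(Y(u,x_0)v,x_2)=\sum_n Y(u_nv,x_2)x_0^{-n-1}$. A vacuum-free vertex algebra is a vector space $V$ with an injective linear map $Y(\cdot,x):V\to(\mathrm{End}\,V)[[x,x^{-1}]]$ such that $Y(u,x)v\in V((x))$ for all $u,v\in V$ and the Jacobi identity (displayed in the claim) holds for all $u,v\in V$. *)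

theory Defs
  imports Complex_Main "HOL-Library.Product_Plus" "HOL-Library.Groups_Big_Fun"
begin

text \<open>
  A formal series (infinite in all directions) is its coefficient function on exponents.  The
  exponents form the additive group \<open>int\<close>, \<open>int \<times> int\<close> or \<open>int \<times> int \<times> int\<close>.  Triples
  \<open>(a, b, c)\<close> always stand for \<open>x0\<^sup>a x1\<^sup>b x2\<^sup>c\<close>; for pairs the variables are named at each
  definition.  A series with coefficients in \<open>End V\<close> is a function \<open>'e \<Rightarrow> 'v \<Rightarrow> 'v\<close>.
\<close>

type_synonym ('e, 'v) op_series = "'e \<Rightarrow> 'v \<Rightarrow> 'v"

text \<open>
  Product of a scalar series with an \<open>End V\<close>-valued series.  As usual in formal calculus, the
  sum giving a coefficient has to be finite after application to each vector; \<open>Sum_any\<close> is the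
  sum over the support of its argument and is meaningful only in that case.  The lemmas
  \<open>finite_support_\<dots>\<close> below show that this is so for every use made of it here.
\<close>

definition series_mult ::
  "(complex \<Rightarrow> 'v \<Rightarrow> 'v) \<Rightarrow> ('e::ab_group_add \<Rightarrow> complex) \<Rightarrow> ('e, 'v::ab_group_add) op_series
    \<Rightarrow> ('e, 'v) op_series" where
  "series_mult scale f G e w = Sum_any (\<lambda>d. scale (f d) (G (e - d) w))"

text \<open>
  \<open>(\<alpha> x + \<beta> y)\<^sup>n\<close>, for any integer \<open>n\<close>, expanded in nonnegative powers of the second-listed
  variable \<open>y\<close>; the exponents are those of \<open>(x, y)\<close>.
\<close>

definition binom_series :: "complex \<Rightarrow> complex \<Rightarrow> int \<Rightarrow> int \<times> int \<Rightarrow> complex" where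
  "binom_series \<alpha> \<beta> n = (\<lambda>(i, j).
     if j \<ge> 0 \<and> i + j = n then (of_int n gchoose nat j) * \<alpha> powi i * \<beta> powi j else 0)"

definition formal_delta :: "int \<Rightarrow> complex" where
  "formal_delta n = 1"

text \<open>
  \<open>z\<^sup>-\<^sup>1 \<delta>((\<alpha> x + \<beta> y) / z)\<close>, the sum over \<open>n\<close> of \<open>\<delta>\<^sub>n (\<alpha> x + \<beta> y)\<^sup>n z\<^sup>-\<^sup>n\<^sup>-\<^sup>1\<close>; the exponents are
  those of \<open>(z, x, y)\<close>.
\<close>

definition delta_over :: "complex \<Rightarrow> complex \<Rightarrow> int \<times> int \<times> int \<Rightarrow> complex" where
  "delta_over \<alpha> \<beta> = (\<lambda>(l, i, j). formal_delta (- l - 1) * binom_series \<alpha> \<beta> (- l - 1) (i, j))"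

definition lower_truncated :: "(int \<Rightarrow> 'v::zero) \<Rightarrow> bool" where
  "lower_truncated f \<longleftrightarrow> (\<exists>N. \<forall>n<N. f n = 0)"

text \<open>
  \<open>Y v k\<close> is the coefficient of \<open>x\<^sup>k\<close> in \<open>Y(v, x)\<close>; so the mode \<open>v\<^sub>n\<close> is \<open>Y v (- n - 1)\<close>.
  Linearity of \<open>Y\<close> is linearity of each coefficient, evaluated at each vector.
\<close>

locale vertex_operator_map = vector_space scale
  for scale :: "complex \<Rightarrow> 'v \<Rightarrow> 'v::ab_group_add" +
  fixes Y :: "'v \<Rightarrow> (int, 'v) op_series"
  assumes endomorphism: "Vector_Spaces.linear scale scale (Y v k)"
    and linear: "Vector_Spaces.linear scale scale (\<lambda>v. Y v k w)"
    and injective: "inj Y"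
    and truncation: "lower_truncated (\<lambda>k. Y u k v)"

text \<open>\<open>Y(u, x1) Y(v, x2)\<close> and \<open>Y(v, x2) Y(u, x1)\<close>, both with the exponents of \<open>(x1, x2)\<close>.\<close>

definition product_uv :: "('v \<Rightarrow> (int, 'v) op_series) \<Rightarrow> 'v \<Rightarrow> 'v \<Rightarrow> (int \<times> int, 'v) op_series" where
  "product_uv Y u v = (\<lambda>(b, c). Y u b \<circ> Y v c)"

definition product_vu :: "('v \<Rightarrow> (int, 'v) op_series) \<Rightarrow> 'v \<Rightarrow> 'v \<Rightarrow> (int \<times> int, 'v) op_series" where
  "product_vu Y u v = (\<lambda>(b, c). Y v c \<circ> Y u b)"

text \<open>\<open>Y(Y(u, x0)v, x2)\<close>, with the exponents of \<open>(x0, x2)\<close>.\<close>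

definition iterate :: "('v \<Rightarrow> (int, 'v) op_series) \<Rightarrow> 'v \<Rightarrow> 'v \<Rightarrow> (int \<times> int, 'v) op_series" where
  "iterate Y u v = (\<lambda>(a, c). Y (Y u a v) c)"

text \<open>Series in \<open>(x1, x2)\<close>, respectively \<open>(x0, x2)\<close>, regarded as series in \<open>(x0, x1, x2)\<close>.\<close>

definition from_x1_x2 :: "(int \<times> int, 'v::zero) op_series \<Rightarrow> (int \<times> int \<times> int, 'v) op_series" where
  "from_x1_x2 F = (\<lambda>(a, b, c) w. if a = 0 then F (b, c) w else 0)"

definition from_x0_x2 :: "(int \<times> int, 'v::zero) op_series \<Rightarrow> (int \<times> int \<times> int, 'v) op_series" where
  "from_x0_x2 F = (\<lambda>(a, b, c) w. if b = 0 then F (a, c) w else 0)"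

text \<open>The scalar arguments of \<open>series_mult\<close> take the variables of \<open>delta_over\<close> in the order
  \<open>(x0; x1, x2)\<close>, \<open>(x0; x2, x1)\<close> and \<open>(x1; x2, x0)\<close>.\<close>

definition jacobi_identity ::
  "(complex \<Rightarrow> 'v \<Rightarrow> 'v::ab_group_add) \<Rightarrow> ('v \<Rightarrow> (int, 'v) op_series) \<Rightarrow> 'v \<Rightarrow> 'v \<Rightarrow> bool" where
  "jacobi_identity scale Y u v \<longleftrightarrow> (\<forall>e w.
     series_mult scale (\<lambda>(a, b, c). delta_over 1 (- 1) (a, b, c)) (from_x1_x2 (product_uv Y u v)) e w
     - series_mult scale (\<lambda>(a, b, c). delta_over (- 1) 1 (a, c, b)) (from_x1_x2 (product_vu Y u v)) e w
     = series_mult scale (\<lambda>(a, b, c). delta_over 1 1 (b, c, a)) (from_x0_x2 (iterate Y u v)) e w)"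

definition weakly_commute ::
  "(complex \<Rightarrow> 'v \<Rightarrow> 'v::ab_group_add) \<Rightarrow> ('v \<Rightarrow> (int, 'v) op_series) \<Rightarrow> 'v \<Rightarrow> 'v \<Rightarrow> bool" where
  "weakly_commute scale Y u v \<longleftrightarrow> (\<exists>m::nat. \<forall>e w.
     series_mult scale (binom_series 1 (- 1) (int m))
       (\<lambda>e w. product_uv Y u v e w - product_vu Y u v e w) e w = 0)"

text \<open>
  \<open>F(- x0, x2 + x0)\<close> for a series \<open>F\<close> in \<open>(x0, x2)\<close>: the sum over \<open>i\<close> and \<open>j\<close> of
  \<open>F\<^sub>i\<^sub>j (- x0)\<^sup>i (x2 + x0)\<^sup>j\<close>, the binomials being expanded in nonnegative powers of \<open>x0\<close>.
\<close>

definition substitute_skew ::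
  "(complex \<Rightarrow> 'v \<Rightarrow> 'v::ab_group_add) \<Rightarrow> (int \<times> int, 'v) op_series \<Rightarrow> (int \<times> int, 'v) op_series" where
  "substitute_skew scale F = (\<lambda>(a, c) w.
     Sum_any (\<lambda>(i, j). scale ((- 1) powi i * binom_series 1 1 j (c, a - i)) (F (i, j) w)))"

definition skew_symmetric ::
  "(complex \<Rightarrow> 'v \<Rightarrow> 'v::ab_group_add) \<Rightarrow> ('v \<Rightarrow> (int, 'v) op_series) \<Rightarrow> 'v \<Rightarrow> 'v \<Rightarrow> bool" where
  "skew_symmetric scale Y u v \<longleftrightarrow> iterate Y u v = substitute_skew scale (iterate Y v u)"


context vertex_operator_map
begin

lemma Y_zero_right [simp]: "Y v k 0 = 0"
proof -
  interpret L: Vector_Spaces.linear scale scale "Y v k" by (rule endomorphism)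
  show ?thesis by (rule L.zero)
qed

lemma Y_zero_left [simp]: "Y 0 k w = 0"
proof -
  interpret L: Vector_Spaces.linear scale scale "\<lambda>v. Y v k w" by (rule linear)
  show ?thesis by (rule L.zero)
qed

lemma finite_support_product_uv:
  "finite {d. scale ((\<lambda>(a, b, c). delta_over 1 (- 1) (a, b, c)) d)
     (from_x1_x2 (product_uv Y u v) (e - d) w) \<noteq> 0}"
proof -
  obtain A B C where e: "e = (A, B, C)" by (cases e)
  obtain N where N: "\<And>k. k < N \<Longrightarrow> Y v k w = 0"
    using truncation[of v w] by (auto simp: lower_truncated_def)
  have "{d. scale ((\<lambda>(a, b, c). delta_over 1 (- 1) (a, b, c)) d)
     (from_x1_x2 (product_uv Y u v) (e - d) w) \<noteq> 0} \<subseteq> (\<lambda>c. (A, - A - 1 - c, c)) ` {0..C - N}"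
    by (auto simp: e delta_over_def binom_series_def from_x1_x2_def product_uv_def image_iff
        split: if_splits) (rule ccontr, simp add: N)+
  then show ?thesis by (rule finite_subset) simp
qed

lemma finite_support_product_vu:
  "finite {d. scale ((\<lambda>(a, b, c). delta_over (- 1) 1 (a, c, b)) d)
     (from_x1_x2 (product_vu Y u v) (e - d) w) \<noteq> 0}"
proof -
  obtain A B C where e: "e = (A, B, C)" by (cases e)
  obtain N where N: "\<And>k. k < N \<Longrightarrow> Y u k w = 0"
    using truncation[of u w] by (auto simp: lower_truncated_def)
  have "{d. scale ((\<lambda>(a, b, c). delta_over (- 1) 1 (a, c, b)) d)
     (from_x1_x2 (product_vu Y u v) (e - d) w) \<noteq> 0} \<subseteq> (\<lambda>b. (A, b, - A - 1 - b)) ` {0..B - N}"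
    by (auto simp: e delta_over_def binom_series_def from_x1_x2_def product_vu_def image_iff
        split: if_splits) (rule ccontr, simp add: N)+
  then show ?thesis by (rule finite_subset) simp
qed

lemma finite_support_iterate:
  "finite {d. scale ((\<lambda>(a, b, c). delta_over 1 1 (b, c, a)) d)
     (from_x0_x2 (iterate Y u v) (e - d) w) \<noteq> 0}"
proof -
  obtain A B C where e: "e = (A, B, C)" by (cases e)
  obtain N where N: "\<And>k. k < N \<Longrightarrow> Y u k v = 0"
    using truncation[of u v] by (auto simp: lower_truncated_def)
  have "{d. scale ((\<lambda>(a, b, c). delta_over 1 1 (b, c, a)) d)
     (from_x0_x2 (iterate Y u v) (e - d) w) \<noteq> 0} \<subseteq> (\<lambda>a. (a, B, - B - 1 - a)) ` {0..A - N}"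
    by (auto simp: e delta_over_def binom_series_def from_x0_x2_def iterate_def image_iff
        split: if_splits) (rule ccontr, simp add: N)+
  then show ?thesis by (rule finite_subset) simp
qed

lemma finite_support_weak_commutativity:
  "finite {d. scale (binom_series 1 (- 1) (int m) d) (G (e - d) w) \<noteq> 0}"
proof -
  have "{d. scale (binom_series 1 (- 1) (int m) d) (G (e - d) w) \<noteq> 0}
     \<subseteq> (\<lambda>j. (int m - j, j)) ` {0..int m}"
  proof
    fix d assume "d \<in> {d. scale (binom_series 1 (- 1) (int m) d) (G (e - d) w) \<noteq> 0}"
    then obtain i j where d: "d = (i, j)" and *: "0 \<le> j" "i + j = int m"
        "((of_int (int m) :: complex) gchoose nat j) \<noteq> 0"
      by (cases d) (auto simp: binom_series_def split: if_splits)
    from *(3) have "m choose nat j \<noteq> 0"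
      using binomial_gbinomial[of m "nat j", where ?'a = complex] by (metis of_int_of_nat_eq of_nat_0)
    then have "nat j \<le> m"
      by (meson binomial_eq_0 not_le)
    with * d show "d \<in> (\<lambda>j. (int m - j, j)) ` {0..int m}"
      by (auto simp: image_iff)
  qed
  then show ?thesis by (rule finite_subset) simp
qed

lemma finite_support_skew:
  "finite {(i, j). scale ((- 1) powi i * binom_series 1 1 j (c, a - i)) (iterate Y v u (i, j) w) \<noteq> 0}"
proof -
  obtain N where N: "\<And>k. k < N \<Longrightarrow> Y v k u = 0"
    using truncation[of v u] by (auto simp: lower_truncated_def)
  have "{(i, j). scale ((- 1) powi i * binom_series 1 1 j (c, a - i)) (iterate Y v u (i, j) w) \<noteq> 0}
     \<subseteq> (\<lambda>i. (i, c + a - i)) ` {N..a}"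
    by (auto simp: binom_series_def iterate_def image_iff split: if_splits) (rule ccontr, simp add: N)+
  then show ?thesis by (rule finite_subset) simp
qed

end

end

theory Submission
  imports Defs "HOL-Computational_Algebra.Formal_Power_Series"
begin

text \<open>
  Write \<open>u\<^sub>n\<close> for the coefficient of \<open>x\<^sup>-\<^sup>n\<^sup>-\<^sup>1\<close> in \<open>Y(u, x)\<close>.  Coefficientwise, the Jacobi identity for
  \<open>u\<close>, \<open>v\<close>, applied to \<open>w\<close>, says that for all integers \<open>l\<close>, \<open>m\<close>, \<open>n\<close> the expression
    \[ J_{uvw}(l,m,n) = \sum_i (-1)^i {l \choose i}
        (u_{l+m-i} v_{n+i} w - (-1)^l v_{n+l-i} u_{m+i} w)
      - \sum_i {m \choose i} (u_{l+i} v)_{m+n-i} w \]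
  vanishes.  Weak commutativity says that for some \<open>l \<ge> 0\<close> the first sum vanishes for all \<open>m\<close>, \<open>n\<close>,
  \<open>w\<close>, and skew-symmetry says that
    \[ (u_l v)_q z = (-1)^{l+1} \sum_k {q \choose k} (v_{l+k} u)_{q-k} z. \]

  Suppose that the Jacobi identity holds.  For large \<open>l\<close> the second sum in \<open>J\<close> is \<open>0\<close> by
  truncation, which gives weak commutativity.  The first sum in \<open>J\<close> is multiplied by \<open>(-1)\<^sup>l\<^sup>+\<^sup>1\<close> when
  \<open>(u, m)\<close> and \<open>(v, n)\<close> are exchanged, hence so is the second; for \<open>m = 0\<close> this is skew-symmetry.

  Conversely, let weak commutativity and skew-symmetry hold.  Pascal's rule gives
  \<open>J(l + 1, m, n) = J(l, m + 1, n) - J(l, m, n + 1)\<close>.  Weak commutativity and truncation give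
  \<open>J(l, m, n) = 0\<close> for large \<open>l\<close>.  If also \<open>J(l, m, n) = 0\<close> for large \<open>m\<close>, then the recursion, read as
  \<open>J(l, m, n + 1) = J(l, m + 1, n) - J(l + 1, m, n)\<close>, gives \<open>J = 0\<close> by a descent in \<open>l\<close> and \<open>m\<close>
  (\<open>jacobi_defect_eq_0\<close>).  Vanishing for large \<open>m\<close>, which amounts to weak associativity, is the point at
  which a vacuum would usually be used: one conjugates by the exponential of the translation
  operator \<open>D\<close>.  Without a vacuum there is no \<open>D\<close> on \<open>V\<close>, but after one more application of \<open>Y\<close> the
  derivative of formal series takes its place.  Since \<open>Y\<close> is injective, nothing is lost by passing
  to \<open>Y(J, x)\<close>, and there skew-symmetry yields
    \[ J_{uvw}(l,m,n)_q z = (-1)^{n+1} \sum_t {q \choose t} J_{uwv}(m,l,n+t)_{q-t} z \]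
  (\<open>jacobi_defect_symmetry\<close>).  So the vanishing for large \<open>l\<close>, applied to the triple \<open>u\<close>, \<open>w\<close>, \<open>v\<close>,
  is the vanishing for large \<open>m\<close> for the triple \<open>u\<close>, \<open>v\<close>, \<open>w\<close>.

  Two of the three sums in \<open>J\<close> are treated by one use of skew-symmetry.  The remaining one
  requires expanding \<open>(u\<^sub>s (v\<^sub>q w))\<^sub>p\<close> by skew-symmetry of \<open>v\<close> and \<open>w\<close>, inside the outer mode
  (\<open>mode_mode_expansion\<close>).  All of these are manipulations of finite sums with binomial weights,
  which reduce to Vandermonde's identity and trinomial revision.
\<close>

section \<open>Finitely supported sums with binomial weights\<close>

lemma Sum_any_reindex_inj:
  assumes "inj h" and "{a. g a \<noteq> 0} \<subseteq> range h"
  shows "Sum_any g = Sum_any (\<lambda>b. g (h b))"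
proof -
  have "{a. g a \<noteq> 0} = h ` {b. g (h b) \<noteq> 0}"
    using assms(2) by auto
  moreover have "inj_on h {b. g (h b) \<noteq> 0}"
    using assms(1) by (rule inj_on_subset) simp
  ultimately show ?thesis
    by (simp add: Sum_any.expand_set sum.reindex o_def)
qed

lemma Sum_any_iterated:
  assumes "finite {(i, j). f i j \<noteq> 0}"
  shows "Sum_any (\<lambda>i. Sum_any (f i)) = Sum_any (\<lambda>(i, j). f i j)"
proof (rule Sum_any.cartesian_product)
  let ?S = "{(i, j). f i j \<noteq> 0}"
  show "finite (fst ` ?S \<times> snd ` ?S)" using assms by simp
  show "{a. \<exists>b. f a b \<noteq> 0} \<times> {b. \<exists>a. f a b \<noteq> 0} \<subseteq> fst ` ?S \<times> snd ` ?S" by force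
qed

text \<open>
  The total over all pairs is grouped by the sum of the two indices.
\<close>

lemma Sum_any_antidiagonal:
  fixes f :: "nat \<Rightarrow> nat \<Rightarrow> 'a::comm_monoid_add"
  assumes "finite {(i, j). f i j \<noteq> 0}"
  shows "Sum_any (\<lambda>i. Sum_any (f i)) = Sum_any (\<lambda>n. \<Sum>i\<le>n. f i (n - i))"
proof -
  let ?h = "\<lambda>(i, j). (i + j, i :: nat)"
  let ?g = "\<lambda>n i. if i \<le> n then f i (n - i) else 0"
  have "inj ?h" by (auto simp: inj_def)
  have range: "{(n, i). ?g n i \<noteq> 0} \<subseteq> ?h ` {(i, j). f i j \<noteq> 0}"
    by (auto simp: image_iff) (metis le_add_diff_inverse)
  have fin: "finite {(n, i). ?g n i \<noteq> 0}"
    by (rule finite_subset[OF range finite_imageI[OF assms]])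
  have "Sum_any (\<lambda>n. \<Sum>i\<le>n. f i (n - i)) = Sum_any (\<lambda>n. Sum_any (?g n))"
    by (simp add: Sum_any.conditionalize)
  also have "\<dots> = Sum_any (\<lambda>(n, i). ?g n i)"
    by (rule Sum_any_iterated[OF fin])
  also have "\<dots> = Sum_any (\<lambda>p. case ?h p of (n, i) \<Rightarrow> ?g n i)"
    by (rule Sum_any_reindex_inj[OF \<open>inj ?h\<close>]) (use range in auto)
  also have "\<dots> = Sum_any (\<lambda>(i, j). f i j)"
    by (auto intro!: Sum_any.cong)
  finally show ?thesis
    by (simp add: Sum_any_iterated[OF assms])
qed

text \<open>
  Truncation bounds a second index only once the first one is fixed.  This non-uniform bound is
  enough, because the first index has a bound of its own.
\<close>

lemma finite_support_of_bounds:
  fixes f :: "nat \<Rightarrow> nat \<Rightarrow> 'a::zero"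
  assumes "\<exists>K. \<forall>i\<ge>K. \<forall>j. f i j = 0" and "\<And>i. \<exists>L. \<forall>j\<ge>L. f i j = 0"
  shows "finite {(i, j). f i j \<noteq> 0}"
proof -
  obtain K where K: "\<And>i j. i \<ge> K \<Longrightarrow> f i j = 0" using assms(1) by blast
  obtain L where L: "\<And>i j. j \<ge> L i \<Longrightarrow> f i j = 0" using assms(2) by metis
  have "{(i, j). f i j \<noteq> 0} \<subseteq> Sigma {..<K} (\<lambda>i. {..<L i})"
    using K L by (auto simp: not_le[symmetric])
  then show ?thesis by (rule finite_subset) simp
qed

lemma finite_support_of_bound:
  fixes f :: "nat \<Rightarrow> 'a::zero"
  assumes "\<exists>K. \<forall>i\<ge>K. f i = 0"
  shows "finite {i. f i \<noteq> 0}"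
proof -
  obtain K where K: "\<And>i. i \<ge> K \<Longrightarrow> f i = 0" using assms by blast
  have "{i. f i \<noteq> 0} \<subseteq> {..<K}"
    using K by (auto simp: not_le[symmetric])
  then show ?thesis by (rule finite_subset) simp
qed

text \<open>
  Multiplication by \<open>(-1)\<^sup>k\<close> for an integer \<open>k\<close>.  Written as a case distinction, it reduces every
  comparison of signs to one of parities.
\<close>

definition signed :: "int \<Rightarrow> 'a \<Rightarrow> 'a::ab_group_add" where
  "signed k x = (if even k then x else - x)"

lemma signed_signed [simp]: "signed j (signed k x) = signed (j + k) x"
  by (simp add: signed_def)

lemma signed_eq_0_iff [simp]: "signed k x = 0 \<longleftrightarrow> x = 0"
  by (simp add: signed_def)

lemma signed_0 [simp]: "signed k 0 = 0"
  by (simp add: signed_def)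

lemma signed_diff: "signed k (x - y) = signed k x - signed k y"
  by (simp add: signed_def)

locale vector_space_char_0 = vector_space scale
  for scale :: "'a::field_char_0 \<Rightarrow> 'v::ab_group_add \<Rightarrow> 'v"
begin

definition binom_sum :: "int \<Rightarrow> (nat \<Rightarrow> 'v) \<Rightarrow> 'v" where
  "binom_sum z f = Sum_any (\<lambda>i. scale (of_int z gchoose i) (f i))"

lemma Sum_any_eq_binom_sum:
  assumes "inj h" and "\<And>i. g (h i) = scale (of_int z gchoose i) (f i)"
    and "\<And>d. g d \<noteq> 0 \<Longrightarrow> \<exists>i. d = h i"
  shows "Sum_any g = binom_sum z f"
proof -
  have "Sum_any g = Sum_any (\<lambda>i. g (h i))"
    by (rule Sum_any_reindex_inj) (use assms(1,3) in auto)
  then show ?thesis by (simp add: binom_sum_def assms(2))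
qed

lemma finite_support_scale:
  "finite {i. f i \<noteq> 0} \<Longrightarrow> finite {i. scale (c i) (f i) \<noteq> 0}"
  by (erule rev_finite_subset) auto

lemma finite_support_scale2:
  "finite {(i, j). f i j \<noteq> 0} \<Longrightarrow> finite {(i, j). scale (c i j) (f i j) \<noteq> 0}"
  by (erule rev_finite_subset) auto

lemma scale_Sum_any: "finite {i. f i \<noteq> 0} \<Longrightarrow> scale c (Sum_any f) = Sum_any (\<lambda>i. scale c (f i))"
  by (subst Sum_any.expand_superset[of "{i. f i \<noteq> 0}"]; auto simp: scale_sum_right)
    (auto intro!: Sum_any.expand_superset[symmetric])

lemma linear_Sum_any:
  assumes h: "Vector_Spaces.linear scale scale h" and fin: "finite {i. f i \<noteq> 0}"
  shows "h (Sum_any f) = Sum_any (\<lambda>i. h (f i))"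
proof -
  interpret L: Vector_Spaces.linear scale scale h by (rule h)
  have "{i. h (f i) \<noteq> 0} \<subseteq> {i. f i \<noteq> 0}" by (auto simp: L.zero)
  then show ?thesis
    by (simp add: Sum_any.expand_superset[OF fin] L.sum)
qed

lemma linear_binom_sum:
  assumes h: "Vector_Spaces.linear scale scale h" and fin: "finite {i. f i \<noteq> 0}"
  shows "h (binom_sum z f) = binom_sum z (\<lambda>i. h (f i))"
proof -
  interpret L: Vector_Spaces.linear scale scale h by (rule h)
  show ?thesis
    by (simp add: binom_sum_def linear_Sum_any[OF h finite_support_scale[OF fin]] L.scale)
qed

lemma binom_sum_uminus: "binom_sum z (\<lambda>i. - f i) = - binom_sum z f"
proof -
  have "{i. - scale (of_int z gchoose i) (f i) \<noteq> 0} = {i. scale (of_int z gchoose i) (f i) \<noteq> 0}"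
    by auto
  then show ?thesis
    by (simp add: binom_sum_def Sum_any.expand_set sum_negf)
qed

lemma binom_sum_signed: "binom_sum z (\<lambda>i. signed k (f i)) = signed k (binom_sum z f)"
  by (auto simp: signed_def binom_sum_uminus)

lemma binom_sum_zero [simp]: "binom_sum z (\<lambda>i. 0) = 0"
  by (simp add: binom_sum_def)

lemma binom_sum_add:
  assumes "finite {i. f i \<noteq> 0}" and "finite {i. g i \<noteq> 0}"
  shows "binom_sum z (\<lambda>i. f i + g i) = binom_sum z f + binom_sum z g"
  unfolding binom_sum_def scale_right_distrib
  by (rule Sum_any.distrib) (rule finite_support_scale assms)+

lemma binom_sum_diff:
  assumes "finite {i. f i \<noteq> 0}" and "finite {i. g i \<noteq> 0}"
  shows "binom_sum z (\<lambda>i. f i - g i) = binom_sum z f - binom_sum z g"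
  using binom_sum_add[of f "\<lambda>i. - g i" z] assms by (simp add: binom_sum_uminus)

lemma binom_sum_0 [simp]: "binom_sum 0 f = f 0"
proof -
  have "scale (0 gchoose i) (f i) = (if i = 0 then f 0 else 0)" for i
    by (cases i) auto
  then show ?thesis
    by (simp add: binom_sum_def)
qed

lemma binom_sum_nat: "binom_sum (int n) f = (\<Sum>i\<le>n. scale (of_nat (n choose i)) (f i))"
  unfolding binom_sum_def
  by (subst Sum_any.expand_superset[of "{..n}"])
    (auto simp: binomial_gbinomial[symmetric] binomial_eq_0_iff not_less)

text \<open>
  This is the source of the recursion for \<open>J\<close>.
\<close>

lemma binom_sum_pascal:
  assumes "finite {i. f i \<noteq> 0}"
  shows "binom_sum (z + 1) f = binom_sum z f + binom_sum z (\<lambda>i. f (Suc i))"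
proof -
  let ?g = "\<lambda>i. scale (case i of 0 \<Rightarrow> 0 | Suc k \<Rightarrow> of_int z gchoose k) (f i)"
  have "(of_int (z + 1) gchoose i :: 'a) =
      (of_int z gchoose i) + (case i of 0 \<Rightarrow> 0 | Suc k \<Rightarrow> of_int z gchoose k)" for i
    by (cases i) (simp_all add: gbinomial_Suc_Suc)
  then have "binom_sum (z + 1) f = Sum_any (\<lambda>i. scale (of_int z gchoose i) (f i) + ?g i)"
    by (simp add: binom_sum_def scale_left_distrib)
  also have "\<dots> = binom_sum z f + Sum_any ?g"
    unfolding binom_sum_def by (rule Sum_any.distrib) (rule finite_support_scale assms)+
  also have "Sum_any ?g = Sum_any (\<lambda>i. ?g (Suc i))"
  proof (rule Sum_any_reindex_inj)
    show "{i. ?g i \<noteq> 0} \<subseteq> range Suc"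
      by (auto simp: image_iff gr0_conv_Suc split: nat.splits)
  qed simp
  finally show ?thesis by (simp add: binom_sum_def)
qed

lemma binom_sum_iterated:
  assumes "finite {(i, j). f i j \<noteq> 0}"
  shows "binom_sum x (\<lambda>i. binom_sum (y i) (f i)) =
    Sum_any (\<lambda>(i, j). scale ((of_int x gchoose i) * (of_int (y i) gchoose j)) (f i j))"
    (is "_ = Sum_any (\<lambda>(i, j). scale (?c i j) (f i j))")
    and "binom_sum x (\<lambda>i. binom_sum (y i) (f i)) =
    Sum_any (\<lambda>i. Sum_any (\<lambda>j. scale ((of_int x gchoose i) * (of_int (y i) gchoose j)) (f i j)))"
proof -
  have fin: "finite {j. f i j \<noteq> 0}" for i
  proof -
    have "{j. f i j \<noteq> 0} \<subseteq> snd ` {(i, j). f i j \<noteq> 0}" by force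
    then show ?thesis by (rule finite_subset) (simp add: assms)
  qed
  show *: "binom_sum x (\<lambda>i. binom_sum (y i) (f i)) = Sum_any (\<lambda>i. Sum_any (\<lambda>j. scale (?c i j) (f i j)))"
    by (simp add: binom_sum_def scale_Sum_any finite_support_scale fin)
  show "binom_sum x (\<lambda>i. binom_sum (y i) (f i)) = Sum_any (\<lambda>(i, j). scale (?c i j) (f i j))"
    unfolding * by (rule Sum_any_iterated) (rule finite_support_scale2 assms)+
qed

lemma binom_sum_swap:
  assumes "finite {(i, j). f i j \<noteq> 0}"
  shows "binom_sum x (\<lambda>i. binom_sum y (f i)) = binom_sum y (\<lambda>j. binom_sum x (\<lambda>i. f i j))"
proof -
  have eq: "{(j, i). f i j \<noteq> 0} = prod.swap ` {(i, j). f i j \<noteq> 0}" by force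
  have fin: "finite {(j, i). f i j \<noteq> 0}" unfolding eq using assms by simp
  have surj: "a \<in> range prod.swap" for a :: "nat \<times> nat"
    by (metis rangeI swap_swap)
  show ?thesis
    unfolding binom_sum_iterated(1)[OF assms] binom_sum_iterated(1)[OF fin]
    by (subst Sum_any_reindex_inj[of prod.swap]) (auto simp: mult.commute surj split_def)
qed

lemma finite_support_binom_sum:
  assumes "finite {(i, j). f i j \<noteq> 0}"
  shows "finite {j. binom_sum x (\<lambda>i. f i j) \<noteq> 0}"
proof -
  have "{j. binom_sum x (\<lambda>i. f i j) \<noteq> 0} \<subseteq> snd ` {(i, j). f i j \<noteq> 0}"
  proof
    fix j assume "j \<in> {j. binom_sum x (\<lambda>i. f i j) \<noteq> 0}"
    then have "\<exists>i. f i j \<noteq> 0" by (rule contrapos_pp) simp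
    then show "j \<in> snd ` {(i, j). f i j \<noteq> 0}" by force
  qed
  then show ?thesis by (rule finite_subset) (simp add: assms)
qed

lemma finite_support_add:
  assumes "finite {k::nat. h k \<noteq> 0}"
  shows "finite {(i, j). h (i + j) \<noteq> 0}"
proof -
  obtain K where "{k. h k \<noteq> 0} \<subseteq> {..K}" using assms by (metis finite_nat_set_iff_bounded_le mem_Collect_eq atMost_iff subsetI)
  then have "{(i, j). h (i + j) \<noteq> 0} \<subseteq> {..K} \<times> {..K}" by fastforce
  then show ?thesis by (rule finite_subset) simp
qed

text \<open>
  When the summand depends on \<open>i + j\<close> only, the weights can be summed first.
\<close>

lemma binom_sum_regroup:
  assumes "finite {k. h k \<noteq> 0}"
  shows "binom_sum x (\<lambda>i. binom_sum y (\<lambda>j. h (i + j))) =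
    Sum_any (\<lambda>k. scale (\<Sum>i\<le>k. (of_int x gchoose i) * (of_int y gchoose (k - i))) (h k))"
proof -
  have "binom_sum x (\<lambda>i. binom_sum y (\<lambda>j. h (i + j))) =
    Sum_any (\<lambda>k. \<Sum>i\<le>k. scale ((of_int x gchoose i) * (of_int y gchoose (k - i))) (h (i + (k - i))))"
    unfolding binom_sum_iterated(2)[OF finite_support_add[OF assms]]
    by (rule Sum_any_antidiagonal) (rule finite_support_scale2 finite_support_add assms)+
  also have "\<dots> = Sum_any (\<lambda>k. scale (\<Sum>i\<le>k. (of_int x gchoose i) * (of_int y gchoose (k - i))) (h k))"
    by (simp add: scale_sum_left)
  finally show ?thesis .
qed

lemma binom_sum_vandermonde:
  assumes "finite {k. h k \<noteq> 0}"
  shows "binom_sum (x + y) h = binom_sum x (\<lambda>i. binom_sum y (\<lambda>j. h (i + j)))"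
  unfolding binom_sum_regroup[OF assms]
  using gbinomial_Vandermonde[of "of_int x :: 'a" "of_int y"]
  by (simp add: binom_sum_def atLeast0AtMost)

text \<open>
  Trinomial revision: choosing \<open>r\<close> out of \<open>q\<close> and then \<open>t\<close> out of \<open>r\<close> has the weight of choosing \<open>t\<close>
  out of \<open>q\<close> and then \<open>p = r - t\<close> out of the other \<open>q - t\<close>.  Terms with \<open>t > r\<close> have weight \<open>0\<close> on the
  left, so that the substitution loses nothing.
\<close>

lemma binom_sum_trinomial:
  assumes "finite {(r, t). g r t \<noteq> 0}"
  shows "binom_sum q (\<lambda>r. binom_sum (int r) (g r)) =
    binom_sum q (\<lambda>t. binom_sum (q - int t) (\<lambda>p. g (t + p) t))"
proof -
  let ?h = "\<lambda>(t, p). (t + p, t :: nat)"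
  let ?F = "\<lambda>(r, t). scale ((of_int q gchoose r) * (of_int (int r) gchoose t)) (g r t)"
  have "inj ?h" by (auto simp: inj_def)
  have eq: "{(t, p). g (t + p) t \<noteq> 0} = ?h -` {(r, t). g r t \<noteq> 0}" by auto
  have fin: "finite {(t, p). g (t + p) t \<noteq> 0}"
    unfolding eq by (rule finite_vimageI) fact+
  have range: "{a. ?F a \<noteq> 0} \<subseteq> range ?h"
  proof
    fix a assume "a \<in> {a. ?F a \<noteq> 0}"
    then obtain r t where a: "a = (r, t)" "(of_nat r gchoose t :: 'a) \<noteq> 0"
      by (cases a) auto
    then have "t \<le> r"
      by (auto simp: binomial_gbinomial[symmetric] not_le[symmetric])
    then have "a = ?h (t, r - t)" by (simp add: a)
    then show "a \<in> range ?h" by (rule range_eqI)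
  qed
  have "binom_sum q (\<lambda>r. binom_sum (int r) (g r)) = Sum_any ?F"
    by (rule binom_sum_iterated(1)[OF assms])
  also have "\<dots> = Sum_any (\<lambda>p. ?F (?h p))"
    by (rule Sum_any_reindex_inj[OF \<open>inj ?h\<close> range])
  also have "\<dots> = Sum_any (\<lambda>(t, p). scale ((of_int q gchoose t) * (of_int (q - int t) gchoose p)) (g (t + p) t))"
    using gbinomial_trinomial_revision[of t "t + p" "of_int q :: 'a" for t p]
    by (intro Sum_any.cong) (auto simp flip: of_nat_add)
  also have "\<dots> = binom_sum q (\<lambda>t. binom_sum (q - int t) (\<lambda>p. g (t + p) t))"
    by (rule binom_sum_iterated(1)[OF fin, symmetric])
  finally show ?thesis .
qed

text \<open>
  With \<open>k = i + j\<close>, the reflection \<open>(-1)\<^sup>j (z choose j) = (j - 1 - z choose j)\<close> turns the inner upper index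
  \<open>l + m - i\<close> into \<open>k - 1 - l - m\<close>, which is the same for all \<open>i\<close>.  So Vandermonde's identity applies and
  gives \<open>(k - 1 - m choose k)\<close>; a second reflection makes this \<open>(-1)\<^sup>k (m choose k)\<close>.
\<close>

lemma binom_sum_vandermonde_reflected:
  assumes "finite {k. h k \<noteq> 0}"
  shows "binom_sum l (\<lambda>i. binom_sum (l + m - int i) (\<lambda>j. signed (int j) (h (i + j)))) =
    binom_sum m (\<lambda>k. signed (int k) (h k))"
proof -
  have coeff: "(\<Sum>i\<le>k. (of_int l gchoose i) * ((-1) ^ (k - i) * (of_int (l + m - int i) gchoose (k - i))))
      = (-1) ^ k * (of_int m gchoose k :: 'a)" for k
  proof -
    have "(-1) ^ (k - i) * (of_int (l + m - int i) gchoose (k - i) :: 'a)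
        = (of_int (int k - 1 - l - m) gchoose (k - i))" if "i \<le> k" for i
      using that gbinomial_negated_upper[of "of_int (int k - 1 - l - m) :: 'a" "k - i"]
      by (simp add: of_nat_diff algebra_simps)
    then have "(\<Sum>i\<le>k. (of_int l gchoose i) * ((-1) ^ (k - i) * (of_int (l + m - int i) gchoose (k - i))))
        = (\<Sum>i\<le>k. (of_int l gchoose i) * (of_int (int k - 1 - l - m) gchoose (k - i) :: 'a))"
      by simp
    also have "\<dots> = (of_int l + of_int (int k - 1 - l - m) gchoose k)"
      by (simp add: gbinomial_Vandermonde atMost_atLeast0)
    also have "\<dots> = (-1) ^ k * (of_int m gchoose k)"
      by (subst gbinomial_negated_upper) (simp add: algebra_simps)
    finally show ?thesis .
  qed
  have sgn: "signed (int j) x = scale ((-1) ^ j) x" for j x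
    by (auto simp: signed_def)
  have fin: "finite {(i, j). signed (int j) (h (i + j)) \<noteq> 0}"
    using finite_support_add[OF assms] by simp
  have "binom_sum l (\<lambda>i. binom_sum (l + m - int i) (\<lambda>j. signed (int j) (h (i + j)))) =
    Sum_any (\<lambda>k. \<Sum>i\<le>k. scale ((of_int l gchoose i) * (of_int (l + m - int i) gchoose (k - i)))
      (signed (int (k - i)) (h (i + (k - i)))))"
    unfolding binom_sum_iterated(2)[OF fin]
    by (rule Sum_any_antidiagonal) (rule finite_support_scale2 fin)+
  also have "\<dots> = Sum_any (\<lambda>k. scale ((-1) ^ k * (of_int m gchoose k)) (h k))"
    unfolding coeff[symmetric] scale_sum_left sgn
    by (intro Sum_any.cong sum.cong) (simp_all add: mult_ac)
  also have "\<dots> = binom_sum m (\<lambda>k. signed (int k) (h k))"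
    by (simp add: binom_sum_def sgn mult.commute)
  finally show ?thesis .
qed

end

section \<open>The identities in terms of modes\<close>

lemma all_modes_triple: "(\<forall>e. P e) \<longleftrightarrow> (\<forall>l m n. P (- l - 1, - m - 1, - n - 1 :: int))"
  for P :: "int \<times> int \<times> int \<Rightarrow> bool"
proof (intro iffI allI)
  fix e :: "int \<times> int \<times> int" assume *: "\<forall>l m n. P (- l - 1, - m - 1, - n - 1)"
  obtain a b c where "e = (a, b, c)" by (cases e)
  with *[rule_format, of "- a - 1" "- b - 1" "- c - 1"] show "P e" by simp
qed simp

lemma all_modes_pair: "(\<forall>e. P e) \<longleftrightarrow> (\<forall>m n. P (- m - 1, - n - 1 :: int))"
  for P :: "int \<times> int \<Rightarrow> bool"
proof (intro iffI allI)
  fix e :: "int \<times> int" assume *: "\<forall>m n. P (- m - 1, - n - 1)"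
  obtain b c where "e = (b, c)" by (cases e)
  with *[rule_format, of "- b - 1" "- c - 1"] show "P e" by simp
qed simp

context vertex_operator_map
begin

sublocale vector_space_char_0 scale ..

definition mode :: "'v \<Rightarrow> int \<Rightarrow> 'v \<Rightarrow> 'v" where
  "mode u n = Y u (- n - 1)"

lemma linear_mode_left: "Vector_Spaces.linear scale scale (\<lambda>u. mode u n w)"
  unfolding mode_def by (rule linear)

lemma linear_mode_right: "Vector_Spaces.linear scale scale (mode u n)"
  unfolding mode_def by (rule endomorphism)

lemma mode_0_left [simp]: "mode 0 n w = 0"
  by (simp add: mode_def)

lemma mode_0_right [simp]: "mode u n 0 = 0"
  by (simp add: mode_def)

lemma mode_signed_left: "mode (signed k u) n w = signed k (mode u n w)"
proof -
  interpret L: Vector_Spaces.linear scale scale "\<lambda>u. mode u n w" by (rule linear_mode_left)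
  show ?thesis by (simp add: signed_def L.neg)
qed

lemma mode_signed_right: "mode u n (signed k w) = signed k (mode u n w)"
proof -
  interpret L: Vector_Spaces.linear scale scale "mode u n" by (rule linear_mode_right)
  show ?thesis by (simp add: signed_def L.neg)
qed

lemma mode_diff_left: "mode (u - v) n w = mode u n w - mode v n w"
proof -
  interpret L: Vector_Spaces.linear scale scale "\<lambda>u. mode u n w" by (rule linear_mode_left)
  show ?thesis by (rule L.diff)
qed

text \<open>
  The form in which injectivity of \<open>Y\<close> enters: an identity in \<open>V\<close> may be tested after applying
  all modes to all vectors.
\<close>

lemma mode_eq_0D:
  assumes "\<And>q z. mode u q z = 0"
  shows "u = 0"
proof -
  have "Y u k z = Y 0 k z" for k z
    using assms[of "- k - 1" z] by (simp add: mode_def)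
  then have "Y u = Y 0" by (intro ext)
  then show ?thesis by (rule injD[OF injective])
qed

lemma mode_truncation: "\<exists>K. \<forall>i\<ge>K. mode u (c + int i) v = 0"
proof -
  obtain N where N: "\<And>k. k < N \<Longrightarrow> Y u k v = 0"
    using truncation[of u v] by (auto simp: lower_truncated_def)
  then have "\<forall>i\<ge>nat (- N - c). mode u (c + int i) v = 0"
    by (auto simp: mode_def)
  then show ?thesis ..
qed

lemma finite_support_mode: "finite {i. mode u (c + int i) v \<noteq> 0}"
  by (rule finite_support_of_bound) (rule mode_truncation)

text \<open>
  Coefficient of \<open>x\<^sub>0\<^sup>-\<^sup>l\<^sup>-\<^sup>1 x\<^sub>1\<^sup>-\<^sup>m\<^sup>-\<^sup>1 x\<^sub>2\<^sup>-\<^sup>n\<^sup>-\<^sup>1\<close> in the first term of the Jacobi identity.  The second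
  term becomes \<open>(-1)\<^sup>l\<close> times the same expression with \<open>(u, m)\<close> and \<open>(v, n)\<close> exchanged.
\<close>

definition product_sum :: "'v \<Rightarrow> 'v \<Rightarrow> 'v \<Rightarrow> int \<Rightarrow> int \<Rightarrow> int \<Rightarrow> 'v" where
  "product_sum u v w l m n =
    binom_sum l (\<lambda>i. signed (int i) (mode u (l + m - int i) (mode v (n + int i) w)))"

text \<open>
  The same coefficient in \<open>x\<^sub>1\<^sup>-\<^sup>1 \<delta>((x\<^sub>2 + x\<^sub>0)/x\<^sub>1) Y(Y(u, x\<^sub>0)v, x\<^sub>2)\<close>.
\<close>

definition iterate_sum :: "'v \<Rightarrow> 'v \<Rightarrow> 'v \<Rightarrow> int \<Rightarrow> int \<Rightarrow> int \<Rightarrow> 'v" where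
  "iterate_sum u v w l m n =
    binom_sum m (\<lambda>i. mode (mode u (l + int i) v) (m + n - int i) w)"

definition commutator_sum :: "'v \<Rightarrow> 'v \<Rightarrow> 'v \<Rightarrow> int \<Rightarrow> int \<Rightarrow> int \<Rightarrow> 'v" where
  "commutator_sum u v w l m n = product_sum u v w l m n - signed l (product_sum v u w l n m)"

text \<open>
  This is \<open>J(l, m, n)\<close> for the triple \<open>u\<close>, \<open>v\<close>, \<open>w\<close>.
\<close>

definition jacobi_defect :: "'v \<Rightarrow> 'v \<Rightarrow> 'v \<Rightarrow> int \<Rightarrow> int \<Rightarrow> int \<Rightarrow> 'v" where
  "jacobi_defect u v w l m n = commutator_sum u v w l m n - iterate_sum u v w l m n"

lemma finite_support_product_modes:
  "finite {i. signed (int i) (mode u (c - int i) (mode v (n + int i) w)) \<noteq> 0}"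
  by (rule finite_subset[OF _ finite_support_mode[of v n w]]) auto

lemma finite_support_iterate_modes:
  "finite {i. mode (mode u (l + int i) v) (c - int i) w \<noteq> 0}"
  by (rule finite_subset[OF _ finite_support_mode[of u l v]]) auto

lemma product_sum_pascal:
  "product_sum u v w (l + 1) m n = product_sum u v w l (m + 1) n - product_sum u v w l m (n + 1)"
proof -
  have "product_sum u v w (l + 1) m n = product_sum u v w l (m + 1) n
      + binom_sum l (\<lambda>i. signed 1 (signed (int i) (mode u (l + m - int i) (mode v (n + 1 + int i) w))))"
    unfolding product_sum_def binom_sum_pascal[OF finite_support_product_modes]
    by (simp add: algebra_simps)
  then show ?thesis
    unfolding binom_sum_signed by (simp add: signed_def product_sum_def)
qed

lemma iterate_sum_pascal:
  "iterate_sum u v w l (m + 1) n = iterate_sum u v w (l + 1) m n + iterate_sum u v w l m (n + 1)"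
  unfolding iterate_sum_def binom_sum_pascal[OF finite_support_iterate_modes]
  by (simp add: algebra_simps)

lemma commutator_sum_pascal:
  "commutator_sum u v w (l + 1) m n = commutator_sum u v w l (m + 1) n - commutator_sum u v w l m (n + 1)"
  unfolding commutator_sum_def product_sum_pascal
  by (simp add: signed_def)

text \<open>
  All terms share this recursion, which expresses that \<open>x\<^sub>0\<close>, \<open>x\<^sub>1\<close> and \<open>x\<^sub>2\<close> satisfy \<open>x\<^sub>0 = x\<^sub>1 - x\<^sub>2\<close> on the
  support of the delta functions.
\<close>

lemma jacobi_defect_pascal:
  "jacobi_defect u v w (l + 1) m n = jacobi_defect u v w l (m + 1) n - jacobi_defect u v w l m (n + 1)"
  unfolding jacobi_defect_def commutator_sum_pascal iterate_sum_pascal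
  by simp

section \<open>Translation of the formal-series identities\<close>

text \<open>
  Each delta function has a line of exponents compatible with a given coefficient; the
  maps \<open>h\<close> below parametrise these lines by the index of the binomial expansion.
\<close>

lemma jacobi_identity_iff:
  "jacobi_identity scale Y u v \<longleftrightarrow> (\<forall>l m n w. jacobi_defect u v w l m n = 0)"
proof -
  have uv: "series_mult scale (\<lambda>(a, b, c). delta_over 1 (- 1) (a, b, c)) (from_x1_x2 (product_uv Y u v))
      (- l - 1, - m - 1, - n - 1) w = product_sum u v w l m n" for l m n w
    unfolding series_mult_def product_sum_def
  proof (rule Sum_any_eq_binom_sum[where h = "\<lambda>i. (- l - 1, l - int i, int i)"], goal_cases)
    case 1 then show ?case by (simp add: inj_def)
  next
    case (2 i) then show ?case
      by (simp add: delta_over_def formal_delta_def binom_series_def from_x1_x2_def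
        product_uv_def mode_def signed_def algebra_simps power_int_minus_left)
  next
    case (3 d) then show ?case
      by (auto simp: delta_over_def binom_series_def from_x1_x2_def split: if_splits prod.splits
        intro!: exI[of _ "nat (snd (snd d))"])
  qed
  have vu: "series_mult scale (\<lambda>(a, b, c). delta_over (- 1) 1 (a, c, b)) (from_x1_x2 (product_vu Y u v))
      (- l - 1, - m - 1, - n - 1) w = signed l (product_sum v u w l n m)" for l m n w
    unfolding series_mult_def product_sum_def binom_sum_signed[symmetric]
  proof (rule Sum_any_eq_binom_sum[where h = "\<lambda>i. (- l - 1, int i, l - int i)"], goal_cases)
    case 1 then show ?case by (simp add: inj_def)
  next
    case (2 i) then show ?case
      by (simp add: delta_over_def formal_delta_def binom_series_def from_x1_x2_def
        product_vu_def mode_def signed_def algebra_simps power_int_minus_left)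
  next
    case (3 d) then show ?case
      by (auto simp: delta_over_def binom_series_def from_x1_x2_def split: if_splits prod.splits
        intro!: exI[of _ "nat (fst (snd d))"])
  qed
  have it: "series_mult scale (\<lambda>(a, b, c). delta_over 1 1 (b, c, a)) (from_x0_x2 (iterate Y u v))
      (- l - 1, - m - 1, - n - 1) w = iterate_sum u v w l m n" for l m n w
    unfolding series_mult_def iterate_sum_def
  proof (rule Sum_any_eq_binom_sum[where h = "\<lambda>i. (int i, - m - 1, m - int i)"], goal_cases)
    case 1 then show ?case by (simp add: inj_def)
  next
    case (2 i) then show ?case
      by (simp add: delta_over_def formal_delta_def binom_series_def from_x0_x2_def
        iterate_def mode_def algebra_simps)
  next
    case (3 d) then show ?case
      by (auto simp: delta_over_def binom_series_def from_x0_x2_def split: if_splits prod.splits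
        intro!: exI[of _ "nat (fst d)"])
  qed
  show ?thesis
    unfolding jacobi_identity_def all_modes_triple uv vu it jacobi_defect_def commutator_sum_def by simp
qed

text \<open>
  For \<open>l = M \<ge> 0\<close> the two binomial expansions are finite and agree up to reversing the order of
  summation, so the two products combine into commutators.
\<close>

lemma commutator_sum_nat:
  "commutator_sum u v w (int M) m n = binom_sum (int M) (\<lambda>j. signed (int j)
    (mode u (int M + m - int j) (mode v (n + int j) w) - mode v (n + int j) (mode u (int M + m - int j) w)))"
proof -
  let ?f = "\<lambda>j. scale (of_nat (M choose j)) (signed (int j) (mode v (n + int j) (mode u (int M + m - int j) w)))"
  have "signed (int M) (product_sum v u w (int M) n m) =
      (\<Sum>i\<le>M. scale (of_nat (M choose i)) (signed (int M + int i) (mode v (int M + n - int i) (mode u (m + int i) w))))"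
    unfolding product_sum_def binom_sum_signed[symmetric] unfolding binom_sum_nat by simp
  also have "\<dots> = (\<Sum>i\<le>M. ?f (M - i))"
    by (intro sum.cong refl arg_cong2[of _ _ _ _ scale])
      (auto simp: binomial_symmetric[symmetric] of_nat_diff algebra_simps signed_def)
  also have "\<dots> = (\<Sum>j\<le>M. ?f j)"
    by (rule sum.reindex_bij_witness[of _ "\<lambda>j. M - j" "\<lambda>i. M - i"]) auto
  finally show ?thesis
    by (simp add: commutator_sum_def product_sum_def binom_sum_nat signed_diff scale_right_diff_distrib sum_subtractf)
qed

lemma weakly_commute_iff:
  "weakly_commute scale Y u v \<longleftrightarrow> (\<exists>M. \<forall>m n w. commutator_sum u v w (int M) m n = 0)"
proof -
  have comm: "series_mult scale (binom_series 1 (- 1) (int M))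
      (\<lambda>e w. product_uv Y u v e w - product_vu Y u v e w) (- m - 1, - n - 1) w
      = commutator_sum u v w (int M) m n" for M m n w
    unfolding series_mult_def commutator_sum_nat
  proof (rule Sum_any_eq_binom_sum[where h = "\<lambda>j. (int M - int j, int j)"], goal_cases)
    case 1 then show ?case by (simp add: inj_def)
  next
    case (2 j) then show ?case
      by (simp add: binom_series_def product_uv_def product_vu_def mode_def signed_def
        algebra_simps power_int_minus_left)
  next
    case (3 d) then show ?case
      by (auto simp: binom_series_def split: if_splits prod.splits intro!: exI[of _ "nat (snd d)"])
  qed
  show ?thesis
    unfolding weakly_commute_def all_modes_pair comm ..
qed

text \<open>
  In \<open>(x\<^sub>2 + x\<^sub>0)\<^sup>j\<close> the binomial coefficient is \<open>(k - n - 1 choose k)\<close>; its reflection is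
  \<open>(-1)\<^sup>k (n choose k)\<close>, and the sign cancels the dependence on \<open>k\<close> of the sign coming from \<open>- x\<^sub>0\<close>.
\<close>

lemma skew_symmetric_iff:
  "skew_symmetric scale Y u v \<longleftrightarrow> (\<forall>l n w. mode (mode u l v) n w =
    signed (l + 1) (binom_sum n (\<lambda>k. mode (mode v (l + int k) u) (n - int k) w)))"
proof -
  have sub: "substitute_skew scale (iterate Y v u) (- l - 1, - n - 1) w =
      signed (l + 1) (binom_sum n (\<lambda>k. mode (mode v (l + int k) u) (n - int k) w))" for l n w
  proof -
    have coeff: "(- 1) powi (- l - 1 - int k) * (of_int (int k - n - 1) gchoose k)
        = (- 1) powi (l + 1) * (of_int n gchoose k :: complex)" for k
      using gbinomial_negated_upper[of "of_int n :: complex" k]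
      by (simp add: power_int_minus_left algebra_simps)
    show ?thesis
      unfolding substitute_skew_def binom_sum_signed[symmetric] prod.case
    proof (rule Sum_any_eq_binom_sum[where h = "\<lambda>k. (- l - 1 - int k, int k - n - 1)"], goal_cases)
      case 1 then show ?case by (simp add: inj_def)
    next
      case (2 k) then show ?case
        using coeff[of k]
        by (simp add: binom_series_def iterate_def mode_def signed_def algebra_simps power_int_minus_left)
    next
      case (3 d) then show ?case
        by (auto simp: binom_series_def split: if_splits prod.splits intro!: exI[of _ "nat (- l - 1 - fst d)"])
    qed
  qed
  show ?thesis
    unfolding skew_symmetric_def fun_eq_iff all_modes_pair sub by (simp add: iterate_def mode_def)
qed

section \<open>Consequences of the Jacobi identity\<close>

text \<open>
  For \<open>m = 0\<close> the iterate sum of \<open>u\<close>, \<open>v\<close> has a single term, \<open>(u\<^sub>l v)\<^sub>n w\<close>, while the one of \<open>v\<close>, \<open>u\<close> is the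
  right-hand side of skew-symmetry.
\<close>

lemma skew_symmetric_of_jacobi:
  assumes "\<And>u v. jacobi_identity scale Y u v"
  shows "skew_symmetric scale Y u v"
  unfolding skew_symmetric_iff
proof (intro allI)
  fix l n w
  have "commutator_sum u v w l 0 n = iterate_sum u v w l 0 n"
    and "commutator_sum v u w l n 0 = iterate_sum v u w l n 0"
    using assms by (simp_all add: jacobi_identity_iff jacobi_defect_def)
  moreover have "commutator_sum u v w l 0 n = signed (l + 1) (commutator_sum v u w l n 0)"
    by (simp add: commutator_sum_def signed_def)
  ultimately show "mode (mode u l v) n w =
      signed (l + 1) (binom_sum n (\<lambda>k. mode (mode v (l + int k) u) (n - int k) w))"
    by (simp add: iterate_sum_def)
qed

lemma iterate_sum_eventually_0: "\<exists>L. \<forall>l\<ge>L. \<forall>m n w. iterate_sum u v w l m n = 0"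
proof -
  obtain N where N: "\<And>k. k < N \<Longrightarrow> Y u k v = 0"
    using truncation[of u v] by (auto simp: lower_truncated_def)
  have "iterate_sum u v w l m n = 0" if "l \<ge> - N" for l m n w
    using that by (simp add: iterate_sum_def mode_def N)
  then show ?thesis by blast
qed

lemma weakly_commute_of_jacobi:
  assumes "jacobi_identity scale Y u v"
  shows "weakly_commute scale Y u v"
proof -
  obtain L where L: "\<And>l m n w. l \<ge> L \<Longrightarrow> iterate_sum u v w l m n = 0"
    using iterate_sum_eventually_0 by blast
  have "commutator_sum u v w (int (nat L)) m n = 0" for m n w
    using assms L[of "int (nat L)"] by (simp add: jacobi_identity_iff jacobi_defect_def)
  then show ?thesis unfolding weakly_commute_iff by blast
qed

section \<open>Descent along the Pascal recursion\<close>

text \<open>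
  Weak commutativity speaks of one exponent \<open>M\<close> only; the recursion carries it to all \<open>l \<ge> M\<close>.
\<close>

lemma jacobi_defect_eventually_0:
  assumes "weakly_commute scale Y u v"
  shows "\<exists>L. \<forall>l\<ge>L. \<forall>m n w. jacobi_defect u v w l m n = 0"
proof -
  obtain L where L: "\<And>l m n w. l \<ge> L \<Longrightarrow> iterate_sum u v w l m n = 0"
    using iterate_sum_eventually_0 by blast
  obtain M where M: "\<And>m n w. commutator_sum u v w (int M) m n = 0"
    using assms by (auto simp: weakly_commute_iff)
  have comm: "commutator_sum u v w l m n = 0" if "l \<ge> int M" for l m n w
    using that by (induction l arbitrary: m n rule: int_ge_induct) (simp_all add: M commutator_sum_pascal)
  have "jacobi_defect u v w l m n = 0" if "l \<ge> max L (int M)" for l m n w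
    using that by (simp add: jacobi_defect_def comm L)
  then show ?thesis by blast
qed

text \<open>
  Solving the recursion for \<open>J(l, m, n)\<close> raises either \<open>l\<close> or \<open>m\<close>, and both are bounded above
  where \<open>J\<close> can be nonzero.
\<close>

lemma jacobi_defect_eq_0:
  assumes L: "\<And>l m n. l \<ge> L \<Longrightarrow> jacobi_defect u v w l m n = 0"
    and M: "\<And>l m n. m \<ge> M \<Longrightarrow> jacobi_defect u v w l m n = 0"
  shows "jacobi_defect u v w l m n = 0"
proof (induction "nat (L - l) + nat (M - m)" arbitrary: l m n rule: less_induct)
  case less
  show ?case
  proof (cases "l \<ge> L \<or> m \<ge> M")
    case True
    then show ?thesis using L M by blast
  next
    case False
    then have "jacobi_defect u v w (l + 1) m (n - 1) = 0" "jacobi_defect u v w l (m + 1) (n - 1) = 0"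
      by (auto intro!: less)
    then show ?thesis
      using jacobi_defect_pascal[of u v w l m "n - 1"] by simp
  qed
qed

section \<open>Symmetry of the Jacobi defect under skew-symmetry\<close>

text \<open>
  Skew-symmetry is now assumed for all pairs of vectors, in the mode form of
  \<open>skew_symmetric_iff\<close>.
\<close>

context
  assumes skew: "\<And>u v l n w. mode (mode u l v) n w =
    signed (l + 1) (binom_sum n (\<lambda>k. mode (mode v (l + int k) u) (n - int k) w))"
begin

text \<open>
  With \<open>D\<close> the derivative in \<open>x\<close>, the hypothesis is \<open>Y(c, x) = \<Sum>\<^sub>k (-D)\<^sup>k/k! Y(b\<^sub>k, x)\<close>.  In the
  conclusion \<open>D\<close> has been moved past \<open>Y(u, x\<^sub>1)\<close>, which replaces it by \<open>D - \<partial>\<close> with \<open>\<partial>\<close> the derivative in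
  \<open>x\<^sub>1\<close>: it is \<open>Y(Y(u, x\<^sub>1)c, x) = \<Sum>\<^sub>k (\<partial> - D)\<^sup>k/k! Y(Y(u, x\<^sub>1)b\<^sub>k, x)\<close>, with \<open>k = j + t\<close>.  This is the rule
  \<open>[D, Y(u, x\<^sub>1)] = \<partial>Y(u, x\<^sub>1)\<close> for a \<open>D\<close> that need not come from an operator on \<open>V\<close>.
  The proof makes \<open>u\<close> the innermost argument by skew-symmetry, which exposes the modes of \<open>c\<close>,
  expands them, and turns \<open>u\<close> back again by skew-symmetry with the vectors \<open>b\<close>.
\<close>

lemma mode_mode_expansion:
  assumes c: "\<And>q z. mode c q z = binom_sum q (\<lambda>k. mode (b k) (q - int k) z)"
    and b: "\<exists>K. \<forall>k\<ge>K. b k = 0"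
  shows "mode (mode u s c) q z =
    binom_sum s (\<lambda>j. binom_sum q (\<lambda>t. signed (int j) (mode (mode u (s - int j) (b (j + t))) (q - int t) z)))"
proof -
  define X where "X r k = mode (mode (b k) (s + int r - int k) u) (q - int r) z" for r k
  obtain K where K: "\<And>k. k \<ge> K \<Longrightarrow> b k = 0" using b by blast
  have "\<exists>R. \<forall>r\<ge>R. X r k = 0" for k
    using mode_truncation[of "b k" "s - int k" u] by - (elim exE, rule exI, auto simp: X_def algebra_simps)
  then obtain R where R: "\<And>r k. r \<ge> R k \<Longrightarrow> X r k = 0" by metis
  have XK: "X r k = 0" if "k \<ge> K" for r k using that by (simp add: X_def K)
  \<comment> \<open>The truncation bounds \<open>R k\<close> become uniform because only finitely many \<open>b k\<close> are nonzero.\<close>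
  have XR: "X r k = 0" if "r \<ge> Max (R ` {..K})" for r k
  proof (cases "k \<le> K")
    case True
    then have "R k \<le> Max (R ` {..K})" by (intro Max_ge) auto
    then show ?thesis using that R[of k r] by linarith
  qed (simp add: XK)
  have fin_b: "finite {k. mode (b k) (x - int k) y \<noteq> 0}" for x y
    by (rule finite_support_of_bound) (use K in \<open>auto intro!: exI[of _ K]\<close>)
  have fin_X1: "finite {k. X r k \<noteq> 0}" for r
    by (rule finite_support_of_bound) (use XK in blast)
  have fin_X2: "finite {(r, t). X r (j + t) \<noteq> 0}" for j
    by (rule finite_support_of_bounds) (use XR XK in \<open>blast, auto intro!: exI[of _ K]\<close>)
  have fin_X3: "finite {(r, j). binom_sum (int r) (\<lambda>t. X r (j + t)) \<noteq> 0}"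
  proof (rule finite_support_of_bounds)
    show "\<exists>N. \<forall>r\<ge>N. \<forall>j. binom_sum (int r) (\<lambda>t. X r (j + t)) = 0"
      by (rule exI[of _ "Max (R ` {..K})"]) (simp add: XR del: Max_le_iff)
    show "\<exists>N. \<forall>j\<ge>N. binom_sum (int r) (\<lambda>t. X r (j + t)) = 0" for r
      by (rule exI[of _ K]) (simp add: XK)
  qed
  have "mode (mode u s c) q z = signed (s + 1) (binom_sum q (\<lambda>r. mode (mode c (s + int r) u) (q - int r) z))"
    by (rule skew)
  also have "\<dots> = signed (s + 1) (binom_sum q (\<lambda>r. binom_sum (s + int r) (X r)))"
    by (simp add: c X_def[abs_def] linear_binom_sum[OF linear_mode_left fin_b])
  also have "\<dots> = signed (s + 1) (binom_sum q (\<lambda>r. binom_sum s (\<lambda>j. binom_sum (int r) (\<lambda>t. X r (j + t)))))"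
    by (simp add: binom_sum_vandermonde[OF fin_X1])
  also have "\<dots> = signed (s + 1) (binom_sum s (\<lambda>j. binom_sum q (\<lambda>r. binom_sum (int r) (\<lambda>t. X r (j + t)))))"
    by (simp add: binom_sum_swap[OF fin_X3])
  also have "\<dots> = signed (s + 1) (binom_sum s (\<lambda>j. binom_sum q (\<lambda>t. binom_sum (q - int t) (\<lambda>p. X (t + p) (j + t)))))"
    by (simp add: binom_sum_trinomial[OF fin_X2])
  also have "\<dots> = binom_sum s (\<lambda>j. binom_sum q (\<lambda>t. signed (s + 1) (binom_sum (q - int t) (\<lambda>p. X (t + p) (j + t)))))"
    by (simp add: binom_sum_signed)
  also have "\<dots> = binom_sum s (\<lambda>j. binom_sum q (\<lambda>t. signed (int j) (mode (mode u (s - int j) (b (j + t))) (q - int t) z)))"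
  proof -
    have "mode (mode u (s - int j) (b (j + t))) (q - int t) z =
      signed (s - int j + 1) (binom_sum (q - int t) (\<lambda>p. X (t + p) (j + t)))" for j t
      unfolding X_def by (subst skew) (simp add: algebra_simps)
    then have "signed (int j) (mode (mode u (s - int j) (b (j + t))) (q - int t) z) =
      signed (s + 1) (binom_sum (q - int t) (\<lambda>p. X (t + p) (j + t)))" for j t
      by simp
    then show ?thesis by simp
  qed
  finally show ?thesis .
qed

text \<open>
  Skew-symmetry of \<open>v\<close> and \<open>w\<close> expresses \<open>v\<^sub>n\<^sub>+\<^sub>i w\<close> through \<open>w\<^sub>n\<^sub>+\<^sub>i\<^sub>+\<^sub>k v\<close>, and
  \<open>mode_mode_expansion\<close> moves this past the mode of \<open>u\<close>.  The summand that results depends on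
  the indices \<open>i\<close> and \<open>j\<close> through \<open>i + j\<close> only, up to a sign, and
  \<open>binom_sum_vandermonde_reflected\<close> turns the weights from \<open>l\<close> into those from \<open>m\<close>.  The
  finiteness of the support is recorded for the later addition of the three sums.
\<close>

lemma product_sum_symmetry:
  "mode (product_sum u v w l m n) q z =
    signed (n + 1) (binom_sum q (\<lambda>t. mode (product_sum u w v m l (n + int t)) (q - int t) z))"
  "finite {t. mode (product_sum u w v m l (n + int t)) (q - int t) z \<noteq> 0}"
proof -
  define h where "h t a = mode (mode u (l + m - int a) (mode w (n + int t + int a) v)) (q - int t) z" for t a
  obtain K where K: "\<And>k. k \<ge> K \<Longrightarrow> mode w (n + int k) v = 0"
    using mode_truncation by blast
  have hK: "h t a = 0" if "t + a \<ge> K" for t a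
    using K[OF that] by (simp add: h_def add.assoc)
  have target: "mode (product_sum u w v m l (n + int t)) (q - int t) z =
      binom_sum m (\<lambda>a. signed (int a) (h t a))" for t
    unfolding product_sum_def linear_binom_sum[OF linear_mode_left finite_support_product_modes]
    by (simp add: h_def mode_signed_left add.commute)
  have fin_h: "finite {a. h t a \<noteq> 0}" for t
    by (rule finite_support_of_bound) (auto intro!: exI[of _ K] hK)
  have fin_jt: "finite {(j, t). signed (int j) (h t (i + j)) \<noteq> 0}" for i
    by (rule finite_support_of_bounds) (auto intro!: exI[of _ K] hK)
  have fin_it: "finite {(i, t). binom_sum (l + m - int i) (\<lambda>j. signed (int j) (h t (i + j))) \<noteq> 0}"
    by (rule finite_support_of_bounds) (auto simp: hK intro!: exI[of _ K])
  have fin_at: "finite {(a, t). signed (int a) (h t a) \<noteq> 0}"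
    using fin_jt[of 0] by simp
  show "finite {t. mode (product_sum u w v m l (n + int t)) (q - int t) z \<noteq> 0}"
    unfolding target by (rule finite_support_binom_sum[OF fin_at])
  have expand: "signed (int i) (mode (mode u (l + m - int i) (mode v (n + int i) w)) q z) =
    signed (n + 1) (binom_sum (l + m - int i) (\<lambda>j. binom_sum q (\<lambda>t. signed (int j) (h t (i + j)))))" for i
  proof -
    define b where "b k = signed (n + int i + 1) (mode w (n + int i + int k) v)" for k
    have "mode (mode v (n + int i) w) q z = binom_sum q (\<lambda>k. mode (b k) (q - int k) z)" for q z
      unfolding b_def mode_signed_left binom_sum_signed by (rule skew)
    moreover have "\<exists>K. \<forall>k\<ge>K. b k = 0"
      using mode_truncation[of w "n + int i" v] by (simp add: b_def)
    ultimately have "mode (mode u (l + m - int i) (mode v (n + int i) w)) q z =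
      binom_sum (l + m - int i) (\<lambda>j. binom_sum q (\<lambda>t. signed (int j)
        (mode (mode u (l + m - int i - int j) (b (j + t))) (q - int t) z)))"
      by (rule mode_mode_expansion)
    also have "\<dots> = signed (n + int i + 1)
      (binom_sum (l + m - int i) (\<lambda>j. binom_sum q (\<lambda>t. signed (int j) (h t (i + j)))))"
      unfolding binom_sum_signed[symmetric]
      by (simp add: b_def h_def mode_signed_left mode_signed_right algebra_simps)
    finally show ?thesis
      by (simp add: signed_def)
  qed
  have "mode (product_sum u v w l m n) q z =
      binom_sum l (\<lambda>i. signed (int i) (mode (mode u (l + m - int i) (mode v (n + int i) w)) q z))"
    unfolding product_sum_def linear_binom_sum[OF linear_mode_left finite_support_product_modes]
    by (simp add: mode_signed_left)
  also have "\<dots> = signed (n + 1) (binom_sum l (\<lambda>i. binom_sum (l + m - int i) (\<lambda>j. binom_sum q (\<lambda>t.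
      signed (int j) (h t (i + j))))))"
    unfolding expand binom_sum_signed ..
  also have "\<dots> = signed (n + 1) (binom_sum q (\<lambda>t. binom_sum l (\<lambda>i. binom_sum (l + m - int i) (\<lambda>j.
      signed (int j) (h t (i + j))))))"
    by (simp add: binom_sum_swap[OF fin_jt] binom_sum_swap[OF fin_it])
  also have "\<dots> = signed (n + 1) (binom_sum q (\<lambda>t. mode (product_sum u w v m l (n + int t)) (q - int t) z))"
    by (simp add: target binom_sum_vandermonde_reflected[OF fin_h])
  finally show "mode (product_sum u v w l m n) q z =
    signed (n + 1) (binom_sum q (\<lambda>t. mode (product_sum u w v m l (n + int t)) (q - int t) z))" .
qed

text \<open>
  Here the outermost product \<open>(u\<^sub>l\<^sub>+\<^sub>i v)\<^sub>p w\<close> is turned around as a whole, and the two sums are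
  interchanged; the binomial weights from \<open>m\<close> stay in place.
\<close>

lemma iterate_sum_symmetry:
  "mode (iterate_sum u v w l m n) q z =
    signed (n + 1) (binom_sum q (\<lambda>t. mode (signed m (product_sum w u v m (n + int t) l)) (q - int t) z))"
  "finite {t. mode (signed m (product_sum w u v m (n + int t) l)) (q - int t) z \<noteq> 0}"
proof -
  define f where "f i t = signed (m + int i)
    (mode (mode w (m + n - int i + int t) (mode u (l + int i) v)) (q - int t) z)" for i t
  have fin: "finite {(i, t). f i t \<noteq> 0}"
  proof (rule finite_support_of_bounds)
    show "\<exists>K. \<forall>i\<ge>K. \<forall>t. f i t = 0"
      using mode_truncation[of u l v] by - (elim exE, rule exI, auto simp: f_def)
    show "\<exists>K. \<forall>t\<ge>K. f i t = 0" for i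
      using mode_truncation[of w "m + n - int i" "mode u (l + int i) v"] by - (elim exE, rule exI, auto simp: f_def)
  qed
  have target: "mode (signed m (product_sum w u v m (n + int t) l)) (q - int t) z =
      binom_sum m (\<lambda>i. f i t)" for t
    unfolding product_sum_def mode_signed_left linear_binom_sum[OF linear_mode_left finite_support_product_modes]
    by (simp add: f_def binom_sum_signed[symmetric] algebra_simps)
  show "finite {t. mode (signed m (product_sum w u v m (n + int t) l)) (q - int t) z \<noteq> 0}"
    unfolding target by (rule finite_support_binom_sum[OF fin])
  have "mode (iterate_sum u v w l m n) q z =
      binom_sum m (\<lambda>i. mode (mode (mode u (l + int i) v) (m + n - int i) w) q z)"
    unfolding iterate_sum_def by (rule linear_binom_sum[OF linear_mode_left finite_support_iterate_modes])
  also have "\<dots> = binom_sum m (\<lambda>i. signed (n + 1) (binom_sum q (f i)))"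
  proof -
    have "mode (mode (mode u (l + int i) v) (m + n - int i) w) q z = signed (n + 1) (binom_sum q (f i))" for i
      unfolding f_def binom_sum_signed by (subst skew) (simp add: signed_def)
    then show ?thesis by simp
  qed
  also have "\<dots> = signed (n + 1) (binom_sum q (\<lambda>t. binom_sum m (\<lambda>i. f i t)))"
    by (simp add: binom_sum_signed binom_sum_swap[OF fin])
  finally show "mode (iterate_sum u v w l m n) q z =
    signed (n + 1) (binom_sum q (\<lambda>t. mode (signed m (product_sum w u v m (n + int t) l)) (q - int t) z))"
    by (simp add: target)
qed

text \<open>
  Likewise with \<open>v\<^sub>p (u\<^sub>m\<^sub>+\<^sub>i w)\<close> turned around.  The sign of skew-symmetry cancels the alternating sign
  of the product sum, as it must, since iterate sums carry none.
\<close>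

lemma opposite_product_sum_symmetry:
  "mode (signed l (product_sum v u w l n m)) q z =
    signed (n + 1) (binom_sum q (\<lambda>t. mode (iterate_sum u w v m l (n + int t)) (q - int t) z))"
  "finite {t. mode (iterate_sum u w v m l (n + int t)) (q - int t) z \<noteq> 0}"
proof -
  define f where "f i t = mode (mode (mode u (m + int i) w) (l + n - int i + int t) v) (q - int t) z" for i t
  have fin: "finite {(i, t). f i t \<noteq> 0}"
  proof (rule finite_support_of_bounds)
    show "\<exists>K. \<forall>i\<ge>K. \<forall>t. f i t = 0"
      using mode_truncation[of u m w] by - (elim exE, rule exI, auto simp: f_def)
    show "\<exists>K. \<forall>t\<ge>K. f i t = 0" for i
      using mode_truncation[of "mode u (m + int i) w" "l + n - int i" v] by - (elim exE, rule exI, auto simp: f_def)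
  qed
  have target: "mode (iterate_sum u w v m l (n + int t)) (q - int t) z = binom_sum l (\<lambda>i. f i t)" for t
    unfolding iterate_sum_def linear_binom_sum[OF linear_mode_left finite_support_iterate_modes]
    by (simp add: f_def algebra_simps)
  show "finite {t. mode (iterate_sum u w v m l (n + int t)) (q - int t) z \<noteq> 0}"
    unfolding target by (rule finite_support_binom_sum[OF fin])
  have "mode (signed l (product_sum v u w l n m)) q z =
      binom_sum l (\<lambda>i. signed (l + int i) (mode (mode v (l + n - int i) (mode u (m + int i) w)) q z))"
    unfolding product_sum_def mode_signed_left linear_binom_sum[OF linear_mode_left finite_support_product_modes]
    by (simp flip: binom_sum_signed)
  also have "\<dots> = binom_sum l (\<lambda>i. signed (n + 1) (binom_sum q (f i)))"
  proof -
    have "signed (l + int i) (mode (mode v (l + n - int i) (mode u (m + int i) w)) q z) =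
        signed (n + 1) (binom_sum q (f i))" for i
      unfolding f_def by (subst skew) (simp add: signed_def)
    then show ?thesis by simp
  qed
  also have "\<dots> = signed (n + 1) (binom_sum q (\<lambda>t. binom_sum l (\<lambda>i. f i t)))"
    by (simp add: binom_sum_signed binom_sum_swap[OF fin])
  finally show "mode (signed l (product_sum v u w l n m)) q z =
    signed (n + 1) (binom_sum q (\<lambda>t. mode (iterate_sum u w v m l (n + int t)) (q - int t) z))"
    by (simp add: target)
qed

text \<open>
  Exchanging \<open>v\<close> and \<open>w\<close> together with \<open>l\<close> and \<open>m\<close> preserves the term with \<open>u\<close> acting last and
  interchanges the two other terms, so the defect is carried to itself.
\<close>

lemma jacobi_defect_symmetry:
  "mode (jacobi_defect u v w l m n) q z =
    signed (n + 1) (binom_sum q (\<lambda>t. mode (jacobi_defect u w v m l (n + int t)) (q - int t) z))"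
proof -
  define P where "P t = mode (product_sum u w v m l (n + int t)) (q - int t) z" for t
  define Q where "Q t = mode (iterate_sum u w v m l (n + int t)) (q - int t) z" for t
  define R where "R t = mode (signed m (product_sum w u v m (n + int t) l)) (q - int t) z" for t
  note fin = product_sum_symmetry(2)[of u w v m l n q z, folded P_def]
    opposite_product_sum_symmetry(2)[of u w v m l n q z, folded Q_def]
    iterate_sum_symmetry(2)[of m w u v n l q z, folded R_def]
  have fin2: "finite {t. P t - Q t \<noteq> 0}"
    by (rule finite_subset[OF _ finite_UnI[OF fin(1,2)]]) auto
  have "mode (jacobi_defect u v w l m n) q z =
      signed (n + 1) (binom_sum q P - binom_sum q Q - binom_sum q R)"
    unfolding jacobi_defect_def commutator_sum_def mode_diff_left signed_diff P_def Q_def R_def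
    by (intro arg_cong2[where f = minus] product_sum_symmetry(1) opposite_product_sum_symmetry(1)
      iterate_sum_symmetry(1))
  also have "binom_sum q P - binom_sum q Q - binom_sum q R = binom_sum q (\<lambda>t. P t - Q t - R t)"
    unfolding binom_sum_diff[OF fin2 fin(3)] binom_sum_diff[OF fin(1,2)] ..
  also have "(\<lambda>t. P t - Q t - R t) = (\<lambda>t. mode (jacobi_defect u w v m l (n + int t)) (q - int t) z)"
    by (simp add: fun_eq_iff P_def Q_def R_def jacobi_defect_def commutator_sum_def mode_diff_left)
  finally show ?thesis .
qed

end

section \<open>The equivalence\<close>

text \<open>
  The descent takes place for one triple of vectors, with the bound for \<open>l\<close> taken from the pair
  \<open>u\<close>, \<open>v\<close> and the bound for \<open>m\<close> from the pair \<open>u\<close>, \<open>w\<close>.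
\<close>

lemma jacobi_of_weakly_commute_skew_symmetric:
  assumes comm: "\<And>u v. weakly_commute scale Y u v" and skew: "\<And>u v. skew_symmetric scale Y u v"
  shows "jacobi_identity scale Y u v"
  unfolding jacobi_identity_iff
proof (intro allI)
  fix l m n w
  obtain L where L: "\<forall>l\<ge>L. \<forall>m n w. jacobi_defect u v w l m n = 0"
    using jacobi_defect_eventually_0[OF comm[of u v]] by (rule exE)
  obtain M where M: "\<forall>l\<ge>M. \<forall>m n v. jacobi_defect u w v l m n = 0"
    using jacobi_defect_eventually_0[OF comm[of u w]] by (rule exE)
  note skew_modes = skew[unfolded skew_symmetric_iff, rule_format]
  have large_m: "jacobi_defect u v w l m n = 0" if "m \<ge> M" for l m n
  proof (rule mode_eq_0D)
    fix q z
    show "mode (jacobi_defect u v w l m n) q z = 0"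
      by (subst jacobi_defect_symmetry[OF skew_modes]) (simp add: M that)
  qed
  have large_l: "jacobi_defect u v w l m n = 0" if "l \<ge> L" for l m n
    using L that by blast
  show "jacobi_defect u v w l m n = 0"
    by (rule jacobi_defect_eq_0[OF large_l large_m])
qed

end

theorem proposition4p6:
  fixes scale :: "complex \<Rightarrow> 'v::ab_group_add \<Rightarrow> 'v"
    and Y :: "'v \<Rightarrow> (int, 'v) op_series"
  assumes "vertex_operator_map scale Y"
  shows "(\<forall>u v. jacobi_identity scale Y u v) \<longleftrightarrow>
    (\<forall>u v. weakly_commute scale Y u v) \<and> (\<forall>u v. skew_symmetric scale Y u v)"
proof -
  interpret vertex_operator_map scale Y by (rule assms)
  show ?thesis
    using weakly_commute_of_jacobi skew_symmetric_of_jacobi jacobi_of_weakly_commute_skew_symmetric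
    by blast
qed

end
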